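(* Let $n,t\in\mathbb{N}$, and let $(k_1,\ldots,k_{n-1})\in L_2$ be the random sample drawn by the bar-drawing algorithm with input $t$ and $n$ (described in the context), where $$L_2=\Big\{(k_1,k_2,\ldots,k_{n-1})\;\colon\;k_1<k_2<\cdots<k_{n-1}<t+n,\ k_1,\ldots,k_{n-1}\in\mathbb{N}\Big\}.$$ Then the sample is drawn uniformly from $L_2$, i.e. for each $(k_1,\ldots,k_{n-1})\in L_2$ the probability that the algorithm outputs $(k_1,\ldots,k_{n-1})$ is $$\mathbf{P}(k_1,\ldots,k_{n-1})=\frac{1}{\binom{n+t-1}{n-1}}.$$
   Context: $\mathbb{N}=\{1,2,3,\ldots\}$. Bar-drawing algorithm, with input $t,n\in\mathbb{N}$ and output $k_1,\ldots,k_{n-1}$. Initialize $N=0$ (number of accepted integers), $V=0$ (number of not accepted integers), and $I=t+n-1$ (the integer currently considered). While $N<n-1$, repeat the following iteration: draw $p$ from the uniform distribution on $[0,1]$, independently of all previous draws. - If $p<\dfrac{n-1-N}{t+n-1-N-V}$, then the integer $I$ is accepted: set $k_{n-1-N}=I$, then increase $N$ by $1$ and decrease $I$ by $1$, and go to the next iteration. - If $p\ge\dfrac{n-1-N}{t+n-1-N-V}$, then the integer $I$ is not accepted: increase $V$ by $1$ and decrease $I$ by $1$, and go to the next iteration. The algorithm stops when $N=n-1$ and returns $(k_1,\ldots,k_{n-1})$. *)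

theory Defs
  imports "HOL-Probability.Probability" "HOL-Library.While_Combinator"
begin

record bar_state =
  accepted :: nat
  rejected :: nat
  current :: int
  bars :: "nat \<Rightarrow> int"

text \<open>
  The entries of \<open>bars\<close> start out unspecified; only the indices \<open>1, \<dots>, n - 1\<close> are ever assigned.
\<close>

definition bar_init :: "nat \<Rightarrow> nat \<Rightarrow> bar_state" where
  "bar_init t n =
     \<lparr>accepted = 0, rejected = 0, current = int t + int n - 1, bars = (\<lambda>_. undefined)\<rparr>"

definition accept_threshold :: "nat \<Rightarrow> nat \<Rightarrow> bar_state \<Rightarrow> real" where
  "accept_threshold t n s =
     (real n - 1 - real (accepted s)) /
     (real t + real n - 1 - real (accepted s) - real (rejected s))"

text \<open>
  Every iteration increments exactly one of the two counters, so \<open>accepted s + rejected s\<close> is the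
  number of completed iterations, and hence the index of the next draw in the sequence \<open>p\<close>.
\<close>

definition bar_step :: "nat \<Rightarrow> nat \<Rightarrow> (nat \<Rightarrow> real) \<Rightarrow> bar_state \<Rightarrow> bar_state" where
  "bar_step t n p s =
     (if p (accepted s + rejected s) < accept_threshold t n s
      then s\<lparr>accepted := accepted s + 1, current := current s - 1,
             bars := (bars s)(n - 1 - accepted s := current s)\<rparr>
      else s\<lparr>rejected := rejected s + 1, current := current s - 1\<rparr>)"

text \<open>
  The result is \<open>None\<close> when the loop does not terminate. This can happen, if only on a null set:
  a draw equal to \<open>1\<close> can reject an integer when the threshold is \<open>1\<close>, after which
  \<open>current\<close> may reach \<open>0\<close> before \<open>n - 1\<close> integers have been accepted.
\<close>

definition bar_drawing :: "nat \<Rightarrow> nat \<Rightarrow> (nat \<Rightarrow> real) \<Rightarrow> int list option" where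
  "bar_drawing t n p =
     map_option (\<lambda>s. map (bars s) [1..<n])
       (while_option (\<lambda>s. accepted s < n - 1) (bar_step t n p) (bar_init t n))"

text \<open>Tuples \<open>(k\<^sub>1, \<dots>, k\<^sub>n\<^sub>-\<^sub>1)\<close> of positive integers with \<open>k\<^sub>1 < \<dots> < k\<^sub>n\<^sub>-\<^sub>1 < t + n\<close>.\<close>

definition L\<^sub>2 :: "nat \<Rightarrow> nat \<Rightarrow> int list set" where
  "L\<^sub>2 t n =
     {ks. length ks = n - 1 \<and> sorted_wrt (<) (ks @ [int t + int n]) \<and> (\<forall>k\<in>set ks. 1 \<le> k)}"

end

theory Submission imports Defs begin

text \<open>
  Put \<open>T = t + n - 1\<close>. The algorithm runs through \<open>T, T - 1, \<dots>, 1\<close> and decides for each integer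
  whether to keep it. Fix a target set \<open>K \<subseteq> {1..T}\<close> with \<open>n - 1\<close> elements. As long as all earlier
  decisions agreed with \<open>K\<close>, the threshold for the integer \<open>I\<close> is \<open>r I / I\<close> with
  \<open>r I = card (K \<inter> {..I})\<close>: of the \<open>I\<close> integers left, \<open>r I\<close> are still to be chosen. This
  threshold is a number depending on \<open>K\<close> and \<open>I\<close> only, so agreement with \<open>K\<close> at all \<open>T\<close> integers
  (\<open>follows\<close>) is a conjunction of conditions on separate draws and has probability
  \<open>\<Prod>I=1..T. (if I \<in> K then r I / I else (I - r I) / I)\<close>. The denominators multiply to \<open>T!\<close>; the
  numerators of the chosen integers run through \<open>1, \<dots>, n - 1\<close> and those of the others through
  \<open>1, \<dots>, T - (n - 1)\<close>. Hence the product is the reciprocal of \<open>T choose (n - 1)\<close>, whatever \<open>K\<close> is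
  (\<open>prod_decision_probabilities\<close>).

  If the draws follow \<open>K\<close>, then the output is \<open>K\<close> in increasing order
  (\<open>bar_drawing_if_follows\<close>). The converse can fail on a null set (a negative draw after the
  algorithm has stopped), but it need not be analysed: the events for different \<open>K\<close> are disjoint, because the outputs differ, and
  there are \<open>T choose (n - 1)\<close> of them, so their probabilities add up to 1. Almost surely, then, the
  draws follow some \<open>K\<close>. This gives almost sure termination with output in \<open>L\<^sub>2\<close>, and it shows
  that the event of a given output differs from the event of following the corresponding \<open>K\<close> by a
  null set. For the last step that event has to be measurable
  (\<open>measurable_bar_drawing_event\<close>).
\<close>

section \<open>The run of the algorithm along a prescribed set\<close>

text \<open>
  The conditions also cover the integers that remain once all of \<open>K\<close> has been passed, which the
  algorithm never considers. There the threshold is \<open>0\<close>, so the condition is \<open>p i \<ge> 0\<close>, which is almost surely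
  true; including it makes the number of conditions independent of \<open>K\<close>.
\<close>

definition follows :: "nat \<Rightarrow> nat set \<Rightarrow> (nat \<Rightarrow> real) \<Rightarrow> bool" where
  "follows T K p \<longleftrightarrow> (\<forall>i<T. p i < real (card (K \<inter> {..T - i})) / real (T - i) \<longleftrightarrow> T - i \<in> K)"

lemma sorted_list_of_set_insert_smallest:
  fixes x :: "'a :: linorder"
  assumes "finite A" "\<And>a. a \<in> A \<Longrightarrow> x < a"
  shows "sorted_list_of_set (insert x A) = x # sorted_list_of_set A"
proof -
  have "x \<notin> A" using assms(2) by blast
  moreover have "insort x (sorted_list_of_set A) = x # sorted_list_of_set A"
    using assms by (intro insort_is_Cons) (auto intro: less_imp_le)
  ultimately show ?thesis using assms(1) by simp
qed

text \<open>
  The loop guard is ignored here: once \<open>n - 1\<close> integers are accepted, further steps along \<open>K\<close> only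
  reject, so the invariant is the same for all \<open>T\<close> steps.
\<close>

lemma state_if_follows:
  assumes "n \<ge> 1" and T: "T = t + n - 1"
    and K: "K \<subseteq> {1..T}" "card K = n - 1"
    and f: "follows T K p" and "i \<le> T"
  defines "s \<equiv> (bar_step t n p ^^ i) (bar_init t n)"
  shows "accepted s = card (K \<inter> {T - i<..})" "accepted s + rejected s = i"
    "current s = int T - int i"
    "map (bars s) [n - accepted s..<n] = map int (sorted_list_of_set (K \<inter> {T - i<..}))"
proof -
  have fin: "finite K" using K(1) finite_subset by blast
  have "accepted s = card (K \<inter> {T - i<..}) \<and> accepted s + rejected s = i \<and>
      current s = int T - int i \<and>
      map (bars s) [n - accepted s..<n] = map int (sorted_list_of_set (K \<inter> {T - i<..}))"
    using \<open>i \<le> T\<close> unfolding s_def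
  proof (induction i)
    case 0
    have *: "K \<inter> {T<..} = {}" using K(1) by auto
    show ?case using assms(1) by (simp add: bar_init_def * T[symmetric]) (simp add: T)
  next
    case (Suc i)
    define s where "s = (bar_step t n p ^^ i) (bar_init t n)"
    define x where "x = T - i"
    define A where "A = K \<inter> {x<..}"
    have x: "x \<ge> 1" "T - Suc i = x - 1" "int T - int i = int x"
      using Suc.prems by (auto simp: x_def)
    have a: "accepted s = card A" and ar: "accepted s + rejected s = i"
      and c: "current s = int x"
      and b: "map (bars s) [n - accepted s..<n] = map int (sorted_list_of_set A)"
      using Suc.IH Suc.prems x(3) unfolding s_def[symmetric] x_def[symmetric] A_def[symmetric]
      by auto
    have finA: "finite A" using fin by (simp add: A_def)
    have split: "card (K \<inter> {..x}) + card A = n - 1"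
    proof -
      have "card ((K \<inter> {..x}) \<union> A) = card (K \<inter> {..x}) + card A"
        using fin unfolding A_def by (intro card_Un_disjoint) auto
      moreover have "(K \<inter> {..x}) \<union> A = K" by (auto simp: A_def)
      ultimately show ?thesis using K(2) by simp
    qed
    have num: "real n - 1 - real (accepted s) = real (card (K \<inter> {..x}))"
      using split a assms(1) by linarith
    have den: "real t + real n - 1 - real (accepted s) - real (rejected s) = real x"
      using ar T assms(1) Suc.prems unfolding x_def by linarith
    \<comment> \<open>The quotient depends on \<open>x\<close> and \<open>K\<close> only, as in \<open>follows\<close>.\<close>
    have decide: "p (accepted s + rejected s) < accept_threshold t n s \<longleftrightarrow> x \<in> K"
      using f Suc.prems unfolding accept_threshold_def num den follows_def ar x_def by auto
    have step: "(bar_step t n p ^^ Suc i) (bar_init t n) = bar_step t n p s"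
      by (simp add: s_def)
    show ?case
    proof (cases "x \<in> K")
      case True
      have ins: "K \<inter> {x - 1<..} = insert x A" using True x(1) by (auto simp: A_def)
      have "x \<notin> A" by (simp add: A_def)
      have "card (K \<inter> {..x}) > 0" using True fin by (auto simp: card_gt_0_iff)
      then have lt: "card A < n - 1" using split by linarith
      then have idx: "[n - Suc (card A)..<n] = (n - 1 - card A) # [n - card A..<n]"
        using upt_conv_Cons[of "n - Suc (card A)" n] by (simp add: Suc_diff_Suc)
      have kept: "map ((bars s)(n - 1 - card A := int x)) [n - card A..<n] =
          map (bars s) [n - card A..<n]"
        using lt by (intro map_cong) auto
      have cons: "sorted_list_of_set (insert x A) = x # sorted_list_of_set A"
        using finA by (rule sorted_list_of_set_insert_smallest) (simp add: A_def)
      have next_state: "bar_step t n p s = s\<lparr>accepted := Suc (card A), current := int x - 1,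
          bars := (bars s)(n - 1 - card A := int x)\<rparr>"
        using True decide a c by (simp add: bar_step_def)
      have "map ((bars s)(n - 1 - card A := int x)) [n - Suc (card A)..<n] =
          map int (sorted_list_of_set (insert x A))"
        unfolding cons idx list.map kept using b a by simp
      moreover have "card (insert x A) = Suc (card A)" using finA \<open>x \<notin> A\<close> by simp
      ultimately show ?thesis
        unfolding step x(2) ins next_state using ar a x(3)
        by (simp add: fun_upd_def del: sorted_list_of_set_insert_remove)
    next
      case False
      have "y > x" if "y \<in> K" "y > x - 1" for y using that False by (cases "y = x") auto
      then have "K \<inter> {x - 1<..} = A" by (auto simp: A_def)
      with False decide ar a c b x(1) Suc.prems show ?thesis
        unfolding step x(2) by (simp add: bar_step_def x_def)
    qed
  qed
  then show "accepted s = card (K \<inter> {T - i<..})" "accepted s + rejected s = i"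
    "current s = int T - int i"
    "map (bars s) [n - accepted s..<n] = map int (sorted_list_of_set (K \<inter> {T - i<..}))"
    by auto
qed

lemma bar_drawing_if_follows:
  assumes "n \<ge> 1" and T: "T = t + n - 1"
    and K: "K \<subseteq> {1..T}" "card K = n - 1"
    and f: "follows T K p"
  shows "bar_drawing t n p = Some (map int (sorted_list_of_set K))"
proof -
  define st where "st i = (bar_step t n p ^^ i) (bar_init t n)" for i
  define k where "k = (LEAST k. \<not> accepted (st k) < n - 1)"
  note inv = state_if_follows[OF assms(1) T K f, folded st_def]
  have fin: "finite K" using K(1) finite_subset by blast
  have "K \<inter> {T - T<..} = K" using K(1) by auto
  then have stop: "\<not> accepted (st T) < n - 1" using inv(1)[of T] K(2) by simp
  have "\<not> accepted (st k) < n - 1" unfolding k_def by (rule LeastI) (rule stop)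
  have "k \<le> T" unfolding k_def by (rule Least_le) (rule stop)
  have "card (K \<inter> {T - k<..}) \<ge> card K"
    using \<open>\<not> accepted (st k) < n - 1\<close> inv(1)[OF \<open>k \<le> T\<close>] K(2) by simp
  then have all: "K \<inter> {T - k<..} = K" using fin by (intro card_seteq) auto
  have out: "map (bars (st k)) [1..<n] = map int (sorted_list_of_set K)"
    using inv(4)[OF \<open>k \<le> T\<close>] inv(1)[OF \<open>k \<le> T\<close>] all K(2) assms(1) by simp
  show ?thesis
    using stop out unfolding bar_drawing_def while_option_def st_def[symmetric] k_def[symmetric]
    by auto
qed

lemma L\<^sub>2_eq_image:
  assumes "t \<ge> 1" "n \<ge> 1"
  shows "L\<^sub>2 t n =
    (\<lambda>K. map int (sorted_list_of_set K)) ` {K. K \<subseteq> {1..t + n - 1} \<and> card K = n - 1}"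
    (is "_ = ?f ` ?S")
proof (intro equalityI subsetI)
  fix ks assume ks: "ks \<in> L\<^sub>2 t n"
  then have s: "sorted_wrt (<) ks" and len: "length ks = n - 1"
    and r: "\<And>k. k \<in> set ks \<Longrightarrow> 1 \<le> k \<and> k < int t + int n"
    by (auto simp: L\<^sub>2_def sorted_wrt_append)
  have s': "sorted_wrt (<) (map nat ks)"
    unfolding sorted_wrt_map using r by (intro sorted_wrt_mono_rel[OF _ s]) fastforce
  have "card (set (map nat ks)) = n - 1"
    using s' len distinct_card[of "map nat ks"] by (simp add: strict_sorted_iff del: set_map)
  moreover have "set (map nat ks) \<subseteq> {1..t + n - 1}" using r by fastforce
  ultimately have "set (map nat ks) \<in> ?S" by blast
  moreover have "sorted_list_of_set (set (map nat ks)) = map nat ks"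
    using s' by (intro sorted_list_of_set.idem_if_sorted_distinct) (auto simp: strict_sorted_iff)
  moreover have "map int (map nat ks) = ks"
    unfolding map_map by (rule map_idI) (use r in fastforce)
  ultimately show "ks \<in> ?f ` ?S" by (intro image_eqI[of _ _ "set (map nat ks)"]) simp_all
next
  fix ks assume "ks \<in> ?f ` ?S"
  then obtain K where K: "K \<subseteq> {1..t + n - 1}" "card K = n - 1" and ks: "ks = ?f K" by auto
  have "finite K" using K(1) finite_subset by blast
  moreover have "1 \<le> int k" "int k < int t + int n" if "k \<in> K" for k
    using K(1) that assms by fastforce+
  ultimately show "ks \<in> L\<^sub>2 t n"
    using K(2) by (auto simp: L\<^sub>2_def ks sorted_wrt_append sorted_wrt_map)
qed

section \<open>The probability of following a prescribed set\<close>

text \<open>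
  The partial product up to \<open>m\<close> is \<open>r! (m - r)! / m!\<close> with \<open>r = card (K \<inter> {..m})\<close>: if \<open>m + 1\<close> is in
  \<open>K\<close>, its factor extends \<open>r!\<close> to \<open>(r + 1)!\<close>, and otherwise \<open>(m - r)!\<close> to \<open>(m - r + 1)!\<close>.
\<close>

lemma prod_decision_probabilities:
  assumes "K \<subseteq> {1..T}"
  shows "(\<Prod>I=1..T. if I \<in> K then real (card (K \<inter> {..I})) / real I
                     else 1 - real (card (K \<inter> {..I})) / real I) = 1 / real (T choose card K)"
proof -
  define r where "r I = card (K \<inter> {..I})" for I
  have fin: "finite K" using assms finite_subset by blast
  have r_le: "r I \<le> I" for I
  proof -
    have "r I \<le> card {1..I}" unfolding r_def using assms by (intro card_mono) auto
    then show ?thesis by simp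
  qed
  have "(\<Prod>I=1..m. if I \<in> K then real (r I) / real I else 1 - real (r I) / real I) =
      fact (r m) * fact (m - r m) / fact m" for m
  proof (induction m)
    case 0
    then show ?case using r_le[of 0] by simp
  next
    case (Suc m)
    have step: "(\<Prod>I=1..Suc m. f I) = (\<Prod>I=1..m. f I) * f (Suc m)" for f :: "nat \<Rightarrow> real"
      by simp
    show ?case
    proof (cases "Suc m \<in> K")
      case True
      then have "K \<inter> {..Suc m} = insert (Suc m) (K \<inter> {..m})" by (auto simp: le_Suc_eq)
      then have "r (Suc m) = Suc (r m)" by (simp add: r_def)
      then show ?thesis unfolding step Suc.IH using True by (simp add: divide_simps)
    next
      case False
      then have "K \<inter> {..Suc m} = K \<inter> {..m}" by (auto simp: le_Suc_eq)
      then have "r (Suc m) = r m" by (simp add: r_def)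
      moreover have "Suc m - r m = Suc (m - r m)" using r_le[of m] by linarith
      moreover have "1 - real (r m) / real (Suc m) = real (Suc (m - r m)) / real (Suc m)"
        using r_le[of m] by (simp add: field_simps of_nat_diff)
      ultimately show ?thesis unfolding step Suc.IH using False by (simp add: divide_simps)
    qed
  qed
  moreover have "K \<inter> {..T} = K" using assms by auto
  then have "r T = card K" by (simp add: r_def)
  ultimately show ?thesis
    using r_le[of T] unfolding r_def[symmetric] by (simp add: binomial_fact)
qed

lemma measure_uniform_unit_interval_lessThan:
  assumes "0 \<le> c" "c \<le> 1"
  shows "measure (uniform_measure lborel {0..1}) {..<c} = (c :: real)"
proof -
  have "{0..1} \<inter> {..<c} = {0..<c}" using assms by auto
  then show ?thesis using assms by (simp add: measure_uniform_measure)
qed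

lemma (in prob_space) prob_follows:
  fixes p :: "nat \<Rightarrow> 'a \<Rightarrow> real"
  assumes ind: "indep_vars (\<lambda>_. borel) p UNIV"
    and unif: "\<And>j. distr M borel (p j) = uniform_measure lborel {0..1}"
    and "T \<ge> 1" "K \<subseteq> {1..T}"
  shows "{\<omega> \<in> space M. follows T K (\<lambda>j. p j \<omega>)} \<in> events"
    and "prob {\<omega> \<in> space M. follows T K (\<lambda>j. p j \<omega>)} = 1 / real (T choose card K)"
proof -
  have meas[measurable]: "p j \<in> borel_measurable M" for j
    using ind by (auto simp: indep_vars_def)
  define c where "c I = real (card (K \<inter> {..I})) / real I" for I
  define B where "B i = {x. x < c (T - i) \<longleftrightarrow> T - i \<in> K}" for i
  have B[measurable]: "B i \<in> sets borel" for i unfolding B_def by measurable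
  have c01: "0 \<le> c I" "c I \<le> 1" for I
  proof -
    have "card (K \<inter> {..I}) \<le> card {1..I}" using assms(4) by (intro card_mono) auto
    then show "0 \<le> c I" "c I \<le> 1" by (auto simp: c_def divide_le_eq_1)
  qed
  have ne: "{..<T} \<noteq> {}" using assms(3) by (simp add: lessThan_empty_iff)
  have eq: "{\<omega> \<in> space M. follows T K (\<lambda>j. p j \<omega>)} = (\<Inter>i\<in>{..<T}. p i -` B i \<inter> space M)"
    using ne by (auto simp: follows_def B_def c_def)
  show "{\<omega> \<in> space M. follows T K (\<lambda>j. p j \<omega>)} \<in> events"
    unfolding eq using ne by (intro sets.finite_INT) auto
  have draw: "prob (p i -` B i \<inter> space M) = (if T - i \<in> K then c (T - i) else 1 - c (T - i))" for i
  proof -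
    interpret U: prob_space "distr M borel (p i)" by (rule prob_space_distr) simp
    have lt: "measure (distr M borel (p i)) {..<c (T - i)} = c (T - i)"
      unfolding unif using c01 by (intro measure_uniform_unit_interval_lessThan)
    have "prob (p i -` B i \<inter> space M) = measure (distr M borel (p i)) (B i)"
      by (simp add: measure_distr)
    also have "\<dots> = (if T - i \<in> K then c (T - i) else 1 - c (T - i))"
    proof (cases "T - i \<in> K")
      case True
      then have "B i = {..<c (T - i)}" by (auto simp: B_def)
      then show ?thesis using True lt by simp
    next
      case False
      then have "B i = space (distr M borel (p i)) - {..<c (T - i)}" by (auto simp: B_def)
      then show ?thesis using False lt U.prob_compl[of "{..<c (T - i)}"] by simp
    qed
    finally show ?thesis .
  qed
  have "prob (\<Inter>i\<in>{..<T}. p i -` B i \<inter> space M) = (\<Prod>i\<in>{..<T}. prob (p i -` B i \<inter> space M))"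
    using ne by (intro indep_varsD[OF ind]) auto
  also have "\<dots> = (\<Prod>I=1..T. if I \<in> K then c I else 1 - c I)"
    unfolding draw
    by (rule prod.reindex_bij_witness[of _ "\<lambda>I. T - I" "\<lambda>i. T - i"]) auto
  also have "\<dots> = 1 / real (T choose card K)"
    unfolding c_def by (rule prod_decision_probabilities[OF assms(4)])
  finally show "prob {\<omega> \<in> space M. follows T K (\<lambda>j. p j \<omega>)} = 1 / real (T choose card K)"
    unfolding eq .
qed

section \<open>Measurability of the output\<close>

text \<open>
  The state space is uncountable, because \<open>bars\<close> is a function on all of \<open>nat\<close>; but each step has
  only two possible results, so after \<open>k\<close> steps the state lies in a finite set that is the same for
  all draws, and measurability reduces to that of the comparisons.
\<close>

lemma measurable_bar_step_iterate:
  fixes p :: "nat \<Rightarrow> 'a \<Rightarrow> real"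
  assumes [measurable]: "\<And>j. p j \<in> borel_measurable M"
  obtains S where "finite S"
    "(\<lambda>\<omega>. (bar_step t n (\<lambda>j. p j \<omega>) ^^ k) (bar_init t n)) \<in> measurable M (count_space S)"
proof (induction k arbitrary: thesis)
  case 0
  show ?case by (rule 0[of "{bar_init t n}"]) auto
next
  case (Suc k)
  obtain S where S: "finite S"
    and f: "(\<lambda>\<omega>. (bar_step t n (\<lambda>j. p j \<omega>) ^^ k) (bar_init t n)) \<in> measurable M (count_space S)"
    by (rule Suc.IH)
  define acc where
    "acc s = s\<lparr>accepted := accepted s + 1, current := current s - 1,
       bars := (bars s)(n - 1 - accepted s := current s)\<rparr>" for s :: bar_state
  define rej where
    "rej s = s\<lparr>rejected := rejected s + 1, current := current s - 1\<rparr>" for s :: bar_state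
  define S' where "S' = acc ` S \<union> rej ` S"
  have "(\<lambda>\<omega>. bar_step t n (\<lambda>j. p j \<omega>) s) \<in> measurable M (count_space S')" if "s \<in> S" for s
  proof -
    have [measurable]: "acc s \<in> space (count_space S')" "rej s \<in> space (count_space S')"
      using that by (auto simp: S'_def)
    show ?thesis unfolding bar_step_def acc_def[symmetric] rej_def[symmetric] by measurable
  qed
  from measurable_compose_countable'[OF this f] S
  have "(\<lambda>\<omega>. (bar_step t n (\<lambda>j. p j \<omega>) ^^ Suc k) (bar_init t n)) \<in> measurable M (count_space S')"
    by (simp add: countable_finite)
  moreover have "finite S'" using S by (simp add: S'_def)
  ultimately show ?case using Suc.prems by blast
qed

lemma measurable_bar_drawing_event:
  fixes p :: "nat \<Rightarrow> 'a \<Rightarrow> real"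
  assumes "\<And>j. p j \<in> borel_measurable M"
  shows "{\<omega> \<in> space M. bar_drawing t n (\<lambda>j. p j \<omega>) = Some ks} \<in> sets M"
proof -
  define st where "st k \<omega> = (bar_step t n (\<lambda>j. p j \<omega>) ^^ k) (bar_init t n)" for k \<omega>
  have [measurable]: "Measurable.pred M (\<lambda>\<omega>. P (st k \<omega>))" for P k
  proof -
    obtain S where "st k \<in> measurable M (count_space S)"
      unfolding st_def[abs_def] by (rule measurable_bar_step_iterate[OF assms, where t = t and n = n and k = k])
    then show ?thesis by (rule measurable_compose) simp
  qed
  have "bar_drawing t n (\<lambda>j. p j \<omega>) = Some ks \<longleftrightarrow>
      (\<exists>k. \<not> accepted (st k \<omega>) < n - 1 \<and> (\<forall>j<k. accepted (st j \<omega>) < n - 1) \<and>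
         map (bars (st k \<omega>)) [1..<n] = ks)" (is "?out \<longleftrightarrow> (\<exists>k. ?Q k)") for \<omega>
  proof
    assume ?out
    then obtain k where "\<not> accepted (st k \<omega>) < n - 1"
      and "map (bars (st (LEAST k. \<not> accepted (st k \<omega>) < n - 1) \<omega>)) [1..<n] = ks"
      unfolding bar_drawing_def while_option_def st_def[symmetric] by (auto split: if_splits)
    moreover from this(1) have "\<not> accepted (st (LEAST k. \<not> accepted (st k \<omega>) < n - 1) \<omega>) < n - 1"
      by (rule LeastI)
    moreover have "accepted (st j \<omega>) < n - 1" if "j < (LEAST k. \<not> accepted (st k \<omega>) < n - 1)" for j
      using not_less_Least[OF that] by simp
    ultimately show "\<exists>k. ?Q k" by metis
  next
    assume "\<exists>k. ?Q k"
    then obtain k where k: "?Q k" by blast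
    then have "(LEAST k. \<not> accepted (st k \<omega>) < n - 1) = k"
      by (intro Least_equality) (auto simp: not_less[symmetric])
    with k show ?out
      unfolding bar_drawing_def while_option_def st_def[symmetric] by auto
  qed
  then show ?thesis by simp
qed

section \<open>Uniformity\<close>

theorem lemma3:
  fixes M :: "'a measure" and p :: "nat \<Rightarrow> 'a \<Rightarrow> real" and t n :: nat
  assumes "prob_space M"
    and "prob_space.indep_vars M (\<lambda>_. borel) p UNIV"
    and "\<And>j. distr M borel (p j) = uniform_measure lborel {0..1}"
    and "t \<ge> 1" and "n \<ge> 1"
  shows "(AE \<omega> in M. \<exists>ks\<in>L\<^sub>2 t n. bar_drawing t n (\<lambda>j. p j \<omega>) = Some ks) \<and>
         (\<forall>ks\<in>L\<^sub>2 t n.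
            measure M {\<omega> \<in> space M. bar_drawing t n (\<lambda>j. p j \<omega>) = Some ks} =
            1 / real ((n + t - 1) choose (n - 1)))"
proof -
  interpret prob_space M by fact
  define T where "T = t + n - 1"
  define S where "S = {K. K \<subseteq> {1..T} \<and> card K = n - 1}"
  define E where "E K = {\<omega> \<in> space M. follows T K (\<lambda>j. p j \<omega>)}" for K
  define list_of where "list_of K = map int (sorted_list_of_set K)" for K
  have T: "T \<ge> 1" "n - 1 \<le> T" using assms(4,5) by (auto simp: T_def)
  have meas: "p j \<in> borel_measurable M" for j
    using assms(2) by (auto simp: indep_vars_def)
  have L: "L\<^sub>2 t n = list_of ` S"
    using L\<^sub>2_eq_image[OF assms(4,5)] by (simp add: S_def T_def list_of_def)
  have E: "E K \<in> events" "prob (E K) = 1 / real (T choose (n - 1))" if "K \<in> S" for K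
    using prob_follows[OF assms(2,3) T(1), of K] that by (auto simp: S_def E_def)
  have out: "bar_drawing t n (\<lambda>j. p j \<omega>) = Some (list_of K)" if "K \<in> S" "\<omega> \<in> E K" for K \<omega>
    using that bar_drawing_if_follows[OF assms(5) T_def, of K]
    by (auto simp: S_def E_def list_of_def)
  have inj: "inj_on list_of S"
  proof (rule inj_onI)
    fix K K' assume "K \<in> S" "K' \<in> S" and eq: "list_of K = list_of K'"
    then have "finite K" "finite K'" by (auto simp: S_def intro: finite_subset)
    moreover have "int ` set (sorted_list_of_set K) = int ` set (sorted_list_of_set K')"
      using eq unfolding list_of_def by (metis set_map)
    ultimately show "K = K'" by (simp add: inj_image_eq_iff)
  qed
  \<comment> \<open>The output determines \<open>K\<close>, so draws cannot follow two different sets.\<close>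
  have disj: "disjoint_family_on E S"
    unfolding disjoint_family_on_def
  proof (intro ballI impI equals0I)
    fix K K' \<omega> assume "K \<in> S" "K' \<in> S" "K \<noteq> K'" "\<omega> \<in> E K \<inter> E K'"
    then have "list_of K = list_of K'" using out[of K \<omega>] out[of K' \<omega>] by simp
    with inj show False using \<open>K \<in> S\<close> \<open>K' \<in> S\<close> \<open>K \<noteq> K'\<close> by (auto dest: inj_onD)
  qed
  have fin: "finite S" unfolding S_def by simp
  have "card S = T choose (n - 1)" unfolding S_def using n_subsets[of "{1..T}"] by simp
  then have "(\<Sum>K\<in>S. prob (E K)) = 1" using E(2) T(2) by simp
  then have "prob (\<Union>K\<in>S. E K) = 1"
    using finite_measure_finite_Union[OF fin _ disj] E(1) by auto
  moreover have "(\<Union>K\<in>S. E K) \<in> events" using fin E(1) by auto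
  ultimately have AE: "AE \<omega> in M. \<omega> \<in> (\<Union>K\<in>S. E K)" using prob_eq_1 by blast
  then have "AE \<omega> in M. \<exists>ks\<in>L\<^sub>2 t n. bar_drawing t n (\<lambda>j. p j \<omega>) = Some ks"
    by eventually_elim (auto simp: L dest: out)
  moreover have "prob {\<omega> \<in> space M. bar_drawing t n (\<lambda>j. p j \<omega>) = Some ks} =
      1 / real ((n + t - 1) choose (n - 1))" if ks: "ks \<in> L\<^sub>2 t n" for ks
  proof -
    obtain K where K: "K \<in> S" "ks = list_of K" using ks unfolding L by blast
    have "AE \<omega> in M. \<omega> \<in> {\<omega> \<in> space M. bar_drawing t n (\<lambda>j. p j \<omega>) = Some ks} \<longleftrightarrow> \<omega> \<in> E K"
      using AE
    proof eventually_elim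
      case (elim \<omega>)
      then obtain K' where K': "K' \<in> S" "\<omega> \<in> E K'" by blast
      then have "\<omega> \<in> space M" by (simp add: E_def)
      moreover have "bar_drawing t n (\<lambda>j. p j \<omega>) = Some (list_of K')" using K' by (rule out)
      moreover have "K' = K" if "list_of K' = list_of K" using inj_onD[OF inj that] K' K by blast
      ultimately show ?case using K K' out[OF K(1), of \<omega>] by auto
    qed
    then have "prob {\<omega> \<in> space M. bar_drawing t n (\<lambda>j. p j \<omega>) = Some ks} = prob (E K)"
      using measurable_bar_drawing_event[OF meas] E(1)[OF K(1)] by (rule finite_measure_eq_AE)
    also have "\<dots> = 1 / real ((n + t - 1) choose (n - 1))"
      using E(2)[OF K(1)] by (simp add: T_def add.commute)
    finally show ?thesis .
  qed
  ultimately show ?thesis by blast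
qed

end
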